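(* Let $a$ be a positive integer with $a>1$. Then for every positive integer $n>14.4a$ there exist prime numbers $p$, $q$, $r$, $s$ such that $n<ap<\frac{3n}{2}<aq<2n$ and simultaneously $n<r<\frac{3n}{2}<s<2n$.
   Context: All inequalities are strict. *)

theory Defs
  imports Complex_Main "HOL-Computational_Algebra.Primes"
begin

end

theory Submission
  imports Defs "HOL-Number_Theory.Prime_Powers" "HOL-Analysis.Harmonic_Numbers"
begin

text \<open>
  Both requirements reduce to the claim that every real \<open>y \<ge> 13\<close> has a prime strictly between
  \<open>y\<close> and \<open>4y/3\<close>, applied to \<open>y = x\<close> and \<open>y = 3x/2\<close> for \<open>x = n/a\<close> and \<open>x = n\<close>.
  For large \<open>y\<close> this is Chebyshev's argument of 1852: writing \<open>T(x) = ln \<lfloor>x\<rfloor>!\<close>, the combination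
  \<open>T(x) - T(x/2) - T(x/3) - T(x/5) + T(x/30)\<close> lies between \<open>\<psi>(x) - \<psi>(x/6)\<close> and \<open>\<psi>(x)\<close>,
  and by Stirling it equals \<open>A x + O(ln x)\<close> with \<open>A = 0.921\<dots>\<close>.  Hence
  \<open>A x - O(ln x) \<le> \<psi>(x) \<le> 6/5 A x + O(ln\<^sup>2 x)\<close>, and since \<open>4/3 > 6/5\<close> the difference
  \<open>\<psi>(4y/3) - \<psi>(y)\<close> exceeds the contribution of the proper prime powers.  An explicit chain of
  primes with successive ratios below \<open>4/3\<close> covers the remaining \<open>y\<close>.
\<close>

section \<open>Chebyshev's psi function and the Mangoldt expansion of factorials\<close>

definition chebyshev_psi :: "nat \<Rightarrow> real" where
  "chebyshev_psi n = (\<Sum>d=1..n. mangoldt d)"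

text \<open>Passing from \<open>n\<close> to \<open>Suc n\<close> raises \<open>n div d\<close> by
  one exactly when \<open>d dvd Suc n\<close>, and the Mangoldt weights of the divisors of
  \<open>Suc n\<close> add up to \<open>ln (Suc n)\<close>.\<close>

lemma ln_fact_conv_mangoldt:
  "ln (fact n :: real) = (\<Sum>d=1..n. mangoldt d * real (n div d))"
proof (induction n)
  case (Suc n)
  have "(\<Sum>d=1..Suc n. mangoldt d * real (Suc n div d)) =
        (\<Sum>d=1..Suc n. mangoldt d * real (n div d) + (if d dvd Suc n then mangoldt d else 0))"
    by (intro sum.cong refl) (auto simp: div_Suc dvd_eq_mod_eq_0 algebra_simps)
  also have "\<dots> = (\<Sum>d=1..Suc n. mangoldt d * real (n div d)) +
                  (\<Sum>d=1..Suc n. if d dvd Suc n then mangoldt d else 0)"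
    by (rule sum.distrib)
  also have "(\<Sum>d=1..Suc n. mangoldt d * real (n div d)) = ln (fact n :: real)"
    using Suc.IH by simp
  also have "(\<Sum>d=1..Suc n. if d dvd Suc n then mangoldt d else 0 :: real) =
             (\<Sum>d | d dvd Suc n. mangoldt d)"
    by (intro sum.mono_neutral_cong_right)
       (auto intro: dvd_pos_nat[of "Suc n"] dvd_imp_le simp: Suc_le_eq)
  also have "\<dots> = ln (real (Suc n))"
    by (subst mangoldt_sum) simp_all
  finally show ?case
    by (simp add: ln_mult add_ac del: of_nat_Suc)
qed simp

text \<open>The two integer divisions commute, and the terms with \<open>d > n div k\<close> vanish.
  Keeping the index range \<open>1..n\<close> for every \<open>k\<close> allows several such
  factorials to be combined term by term.\<close>

lemma ln_fact_div_conv_mangoldt: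
  "ln (fact (n div k) :: real) = (\<Sum>d=1..n. mangoldt d * real ((n div d) div k))"
proof -
  have "(\<Sum>d=1..n. mangoldt d * real ((n div d) div k)) =
        (\<Sum>d=1..n. mangoldt d * real ((n div k) div d))"
    by (simp add: div_mult2_eq [symmetric] mult.commute)
  also have "\<dots> =
        (\<Sum>d=1..n div k. mangoldt d * real ((n div k) div d))"
    by (intro sum.mono_neutral_cong_right)
       (auto intro: order_trans[OF _ div_le_dividend])
  finally show ?thesis
    by (simp add: ln_fact_conv_mangoldt)
qed

section \<open>Chebyshev's combination of factorials and its Mangoldt weights\<close>

definition chebyshev_quotient :: "nat \<Rightarrow> real" where
  "chebyshev_quotient n =
     ln (fact n) + ln (fact (n div 30)) - ln (fact (n div 2)) - ln (fact (n div 3)) - ln (fact (n div 5))"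

text \<open>Since 1 + 1/30 = 1/2 + 1/3 + 1/5, both sides grow by 31 when \<open>m\<close> grows by
  30, so the weight is periodic and only the residues below 30 have to be checked.\<close>

lemma chebyshev_weight_bounds:
  fixes m :: nat
  shows "m div 2 + m div 3 + m div 5 \<le> m + m div 30"
    and "m + m div 30 \<le> m div 2 + m div 3 + m div 5 + 1"
proof -
  define q r where "q = m div 30" and "r = m mod 30"
  have m: "m = r + q * 30" and r: "r \<in> {..<30}"
    by (simp_all add: q_def r_def)
  have "r div 2 + r div 3 + r div 5 \<le> r \<and> r \<le> r div 2 + r div 3 + r div 5 + 1"
    using r by (simp add: lessThan_nat_numeral lessThan_Suc) (elim disjE; simp)
  moreover have "m div 2 = r div 2 + 15 * q" "m div 3 = r div 3 + 10 * q" "m div 5 = r div 5 + 6 * q"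
    unfolding m by linarith+
  moreover have "m div 30 = q"
    by (simp add: q_def)
  ultimately show "m div 2 + m div 3 + m div 5 \<le> m + m div 30"
    and "m + m div 30 \<le> m div 2 + m div 3 + m div 5 + 1"
    using m by linarith+
qed

lemma chebyshev_weight_small:
  fixes m :: nat
  assumes "0 < m" "m < 6"
  shows   "m + m div 30 = m div 2 + m div 3 + m div 5 + 1"
proof -
  have "m \<in> {1, 2, 3, 4, 5}"
    using assms by auto
  thus ?thesis by auto
qed

lemma chebyshev_quotient_conv_mangoldt:
  "chebyshev_quotient n = (\<Sum>d=1..n. mangoldt d *
     (real (n div d + n div d div 30) - real (n div d div 2 + n div d div 3 + n div d div 5)))"
  unfolding chebyshev_quotient_def ln_fact_div_conv_mangoldt ln_fact_conv_mangoldt[of n]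
  by (simp add: sum.distrib sum_subtractf algebra_simps)

lemma chebyshev_quotient_le_psi: "chebyshev_quotient n \<le> chebyshev_psi n"
  unfolding chebyshev_quotient_conv_mangoldt chebyshev_psi_def
proof (intro sum_mono)
  fix d
  have "real (n div d + n div d div 30) \<le> real (n div d div 2 + n div d div 3 + n div d div 5 + 1)"
    by (intro of_nat_mono chebyshev_weight_bounds)
  thus "mangoldt d * (real (n div d + n div d div 30) -
          real (n div d div 2 + n div d div 3 + n div d div 5)) \<le> mangoldt d"
    by (intro mult_left_le) (auto simp: mangoldt_nonneg)
qed

lemma psi_diff_le_chebyshev_quotient:
  "chebyshev_psi n - chebyshev_psi (n div 6) \<le> chebyshev_quotient n"
proof -
  let ?c = "\<lambda>m. real (m + m div 30) - real (m div 2 + m div 3 + m div 5)"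
  have "chebyshev_psi n = (\<Sum>d\<in>{1..n div 6} \<union> {n div 6<..n}. mangoldt d)"
    unfolding chebyshev_psi_def by (intro sum.cong) auto
  also have "\<dots> = chebyshev_psi (n div 6) + (\<Sum>d\<in>{n div 6<..n}. mangoldt d)"
    unfolding chebyshev_psi_def by (intro sum.union_disjoint) auto
  finally have "chebyshev_psi n - chebyshev_psi (n div 6) = (\<Sum>d\<in>{n div 6<..n}. mangoldt d)"
    by simp
  also have "\<dots> = (\<Sum>d\<in>{n div 6<..n}. mangoldt d * ?c (n div d))"
  proof (intro sum.cong refl)
    fix d assume d: "d \<in> {n div 6<..n}"
    have "0 < n div d"
      using d by (auto simp: div_greater_zero_iff)
    moreover have "n div d < 6"
      using d by (auto simp: div_less_iff_less_mult mult.commute)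
    ultimately have "n div d + n div d div 30 = n div d div 2 + n div d div 3 + n div d div 5 + 1"
      by (rule chebyshev_weight_small)
    thus "mangoldt d = mangoldt d * ?c (n div d)"
      by (simp only: of_nat_add) simp
  qed
  also have "\<dots> \<le> (\<Sum>d=1..n. mangoldt d * ?c (n div d))"
  proof (intro sum_mono2)
    fix d
    show "0 \<le> mangoldt d * ?c (n div d)"
      by (intro mult_nonneg_nonneg mangoldt_nonneg)
         (simp only: diff_ge_0_iff_ge of_nat_le_iff chebyshev_weight_bounds)
  qed auto
  finally show ?thesis
    by (simp only: chebyshev_quotient_conv_mangoldt)
qed

section \<open>Stirling-type bounds for factorials of integer quotients\<close>

lemma ln_fact_lower:
  assumes "n \<ge> 1"
  shows   "real n * ln n - n + 1 \<le> ln (fact n)"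
  using assms
proof (induction n rule: dec_induct)
  case (step n)
  hence n: "real n > 0" by simp
  \<comment> \<open>Multiplied by \<open>n\<close>, this bounds by 1 the excess of the growth of
    \<open>n * ln n - n\<close> over the growth \<open>ln (n + 1)\<close> of the log
    factorial.\<close>
  have "ln ((real n + 1) / n) \<le> (real n + 1) / n - 1"
    using n by (intro ln_le_minus_one) auto
  hence "n * (ln (real n + 1) - ln n) \<le> n * ((real n + 1) / n - 1)"
    using n by (intro mult_left_mono) (auto simp: ln_div)
  also have "\<dots> = 1"
    using n by (simp add: field_simps)
  finally have "n * (ln (real n + 1) - ln n) \<le> 1" .
  moreover have "ln (fact (Suc n) :: real) = ln (real n + 1) + ln (fact n)"
    using n by (simp add: ln_mult add_ac)
  ultimately show ?case
    using step.IH by (simp add: algebra_simps)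
qed simp

lemma ln_fact_upper:
  assumes "n \<ge> 1"
  shows   "ln (fact n) \<le> real n * ln n - n + 1 + ln n"
  using assms
proof (induction n rule: dec_induct)
  case (step n)
  hence n: "real n > 0" by simp
  have "ln (n / (real n + 1)) \<le> n / (real n + 1) - 1"
    using n by (intro ln_le_minus_one) auto
  hence "(real n + 1) * (ln n - ln (real n + 1)) \<le> (real n + 1) * (n / (real n + 1) - 1)"
    using n by (intro mult_left_mono) (auto simp: ln_div)
  also have "\<dots> = -1"
    using n by (simp add: field_simps)
  finally have "(real n + 1) * (ln n - ln (real n + 1)) \<le> -1" .
  moreover have "ln (fact (Suc n) :: real) = ln (real n + 1) + ln (fact n)"
    using n by (simp add: ln_mult add_ac)
  ultimately show ?case
    using step.IH by (simp add: algebra_simps)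
qed simp

text \<open>The function \<open>x * ln x - x\<close> is convex with derivative \<open>ln x\<close>,
  so it lies above its tangent at \<open>y\<close>.\<close>

lemma mult_ln_minus_self_diff_le:
  fixes x y :: real
  assumes "0 < x" "0 < y"
  shows   "(y * ln y - y) - (x * ln x - x) \<le> (y - x) * ln y"
proof -
  have "ln (y / x) \<le> y / x - 1"
    using assms by (intro ln_le_minus_one) auto
  hence "x * (ln y - ln x) \<le> x * (y / x - 1)"
    using assms by (intro mult_left_mono) (auto simp: ln_div)
  also have "\<dots> = y - x"
    using assms by (simp add: field_simps)
  finally show ?thesis
    by (simp add: algebra_simps)
qed

text \<open>Rounding \<open>z\<close> down to \<open>n div k\<close> moves the argument by at most
  1, where the slope of \<open>x * ln x - x\<close> is at most \<open>ln z\<close>. This is the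
  source of the term \<open>- ln z\<close>.\<close>

lemma ln_fact_div_lower:
  assumes "k > 0" "n \<ge> k"
  defines "z \<equiv> real n / k"
  shows   "z * ln z - z + 1 - ln z \<le> ln (fact (n div k))"
proof -
  have m: "n div k \<ge> 1"
    using assms by (simp add: Suc_le_eq div_greater_zero_iff)
  have z: "z \<ge> 1" "z - real (n div k) \<le> 1"
    using assms floor_divide_of_nat_eq[of n k, where ?'a = real] by (simp_all add: z_def) linarith
  have "(z * ln z - z) - (real (n div k) * ln (real (n div k)) - real (n div k)) \<le>
        (z - real (n div k)) * ln z"
    using m z by (intro mult_ln_minus_self_diff_le) auto
  also have "\<dots> \<le> 1 * ln z"
    using z by (intro mult_right_mono) auto
  finally show ?thesis
    using ln_fact_lower[OF m] by simp
qed

lemma ln_fact_div_upper: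
  assumes "k > 0" "n \<ge> k"
  defines "z \<equiv> real n / k"
  shows   "ln (fact (n div k)) \<le> z * ln z - z + 1 + ln z"
proof -
  have m: "n div k \<ge> 1"
    using assms by (simp add: Suc_le_eq div_greater_zero_iff)
  have z: "real (n div k) \<le> z"
    by (simp add: z_def of_nat_div_le_of_nat)
  have "(real (n div k) * ln (real (n div k)) - real (n div k)) - (z * ln z - z) \<le>
        (real (n div k) - z) * ln (real (n div k))"
    using m z by (intro mult_ln_minus_self_diff_le) auto
  also have "\<dots> \<le> 0"
    using m z by (intro mult_nonpos_nonneg) auto
  finally have "(real (n div k) * ln (real (n div k)) - real (n div k)) \<le> z * ln z - z" by simp
  moreover have "ln (real (n div k)) \<le> ln z"
    using m z by simp
  ultimately show ?thesis
    using ln_fact_upper[OF m] by linarith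
qed

section \<open>Numerical logarithms and the leading constant\<close>

lemma ln_2_bounds: "ln (2 :: real) \<in> {0.693..0.694}"
  using ln_approx_bounds[of 2 3] by (simp add: eval_nat_numeral)

lemma ln_3_bounds: "ln (3 :: real) \<in> {1.09..1.1}"
  using ln_approx_bounds[of 3 3] by (simp add: eval_nat_numeral)

lemma ln_5_bounds: "ln (5 :: real) \<in> {1.6..1.612}"
proof -
  have "ln (5 :: real) = 2 * ln 2 + ln (5 / 4)"
    using ln_mult[of 4 "5 / 4 :: real"] ln_mult[of 2 "2 :: real"] by simp
  thus ?thesis
    using ln_approx_bounds[of "5 / 4" 1] ln_2_bounds by (simp add: eval_nat_numeral)
qed

lemma ln_6_eq: "ln (6 :: real) = ln 2 + ln 3"
  and ln_10_eq: "ln (10 :: real) = ln 2 + ln 5"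
  and ln_30_eq: "ln (30 :: real) = ln 2 + ln 3 + ln 5"
  using ln_mult[of 2 "3 :: real"] ln_mult[of 2 "5 :: real"] ln_mult[of 6 "5 :: real"] by simp_all

text \<open>This is ln 2 / 2 + ln 3 / 3 + ln 5 / 5 - ln 30 / 30, the coefficient of \<open>n\<close>
  left by Stirling once the \<open>n * ln n\<close> and \<open>n\<close> terms cancel.\<close>

definition chebyshev_const :: real where
  "chebyshev_const = (14 * ln 2 + 9 * ln 3 + 5 * ln 5) / 30"

lemma chebyshev_const_ge: "chebyshev_const \<ge> 0.9"
  using ln_2_bounds ln_3_bounds ln_5_bounds by (simp add: chebyshev_const_def)

section \<open>Linear estimates for the combination and for psi\<close>

lemma chebyshev_quotient_ge:
  assumes "n \<ge> 30"
  shows   "chebyshev_const * n - 5 * ln n + 2 * ln 30 - 1 \<le> chebyshev_quotient n"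
proof -
  have "n * ln n - n + 1 - ln n \<le> ln (fact n)"
    using ln_fact_div_lower[of 1 n] assms by simp
  moreover have "n / 30 * (ln n - ln 30) - n / 30 + 1 - (ln n - ln 30) \<le> ln (fact (n div 30))"
    using ln_fact_div_lower[of 30 n] assms by (simp add: ln_div)
  moreover have "ln (fact (n div 2)) \<le> n / 2 * (ln n - ln 2) - n / 2 + 1 + (ln n - ln 2)"
    using ln_fact_div_upper[of 2 n] assms by (simp add: ln_div)
  moreover have "ln (fact (n div 3)) \<le> n / 3 * (ln n - ln 3) - n / 3 + 1 + (ln n - ln 3)"
    using ln_fact_div_upper[of 3 n] assms by (simp add: ln_div)
  moreover have "ln (fact (n div 5)) \<le> n / 5 * (ln n - ln 5) - n / 5 + 1 + (ln n - ln 5)"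
    using ln_fact_div_upper[of 5 n] assms by (simp add: ln_div)
  ultimately show ?thesis
    unfolding chebyshev_quotient_def chebyshev_const_def ln_30_eq
    by (simp add: field_simps)
qed

lemma chebyshev_quotient_le:
  assumes "n \<ge> 6"
  shows   "chebyshev_quotient n \<le> chebyshev_const * n + 5 * ln n - ln 30 - 1"
proof -
  have "ln (fact n) \<le> n * ln n - n + 1 + ln n"
    using ln_fact_div_upper[of 1 n] assms by simp
  moreover have "ln (fact (n div 30)) \<le> n / 30 * (ln n - ln 30) - n / 30 + 1 + ln n"
  proof (cases "n \<ge> 30")
    case True
    have "ln (fact (n div 30)) \<le> n / 30 * (ln n - ln 30) - n / 30 + 1 + (ln n - ln 30)"
      using ln_fact_div_upper[of 30 n] True by (simp add: ln_div)
    thus ?thesis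
      using ln_ge_zero[of 30] by linarith
  next
    case False
    \<comment> \<open>Here \<open>n div 30 = 0\<close>, so the log factorial is 0. The tangent of
      \<open>z * ln z - z\<close> at 1 is the constant -1, hence the bound at
      \<open>z = n / 30\<close>.\<close>
    have "0 \<le> n / 30 * (ln n - ln 30) - n / 30 + 1"
      using mult_ln_minus_self_diff_le[of "n / 30" 1] assms by (simp add: ln_div)
    moreover have "ln (real n) \<ge> 0"
      using assms by simp
    ultimately show ?thesis
      using False by simp
  qed
  moreover have "n / 2 * (ln n - ln 2) - n / 2 + 1 - (ln n - ln 2) \<le> ln (fact (n div 2))"
    using ln_fact_div_lower[of 2 n] assms by (simp add: ln_div)
  moreover have "n / 3 * (ln n - ln 3) - n / 3 + 1 - (ln n - ln 3) \<le> ln (fact (n div 3))"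
    using ln_fact_div_lower[of 3 n] assms by (simp add: ln_div)
  moreover have "n / 5 * (ln n - ln 5) - n / 5 + 1 - (ln n - ln 5) \<le> ln (fact (n div 5))"
    using ln_fact_div_lower[of 5 n] assms by (simp add: ln_div)
  ultimately show ?thesis
    unfolding chebyshev_quotient_def chebyshev_const_def ln_30_eq
    by (simp add: field_simps)
qed

lemma chebyshev_psi_le_ln_fact: "chebyshev_psi n \<le> ln (fact n)"
  unfolding chebyshev_psi_def ln_fact_conv_mangoldt
proof (intro sum_mono)
  fix d assume "d \<in> {1..n}"
  hence "1 \<le> n div d"
    by (simp add: Suc_le_eq div_greater_zero_iff)
  thus "mangoldt d \<le> mangoldt d * real (n div d)"
    using mult_left_mono[of 1 "real (n div d)" "mangoldt d"] by (simp add: mangoldt_nonneg)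
qed

lemma chebyshev_psi_ge:
  assumes "n \<ge> 30"
  shows   "chebyshev_const * n - 5 * ln n + 2 * ln 30 - 1 \<le> chebyshev_psi n"
  using chebyshev_quotient_ge[OF assms] chebyshev_quotient_le_psi[of n] by linarith

text \<open>Iterating the bound on psi(n) - psi(n/6) gives the factor 1 + 1/6 + 1/36 + ... = 6/5.
  About ln n / ln 6 rounds, each with an error of order ln n, give the squared logarithm.\<close>

lemma chebyshev_psi_le:
  assumes "n \<ge> 1"
  shows   "chebyshev_psi n \<le> 6 / 5 * chebyshev_const * n + 3 / 2 * (ln n)\<^sup>2 + ln n"
  using assms
proof (induction n rule: less_induct)
  case (less n)
  show ?case
  proof (cases "n < 6")
    case True
    hence "n \<in> {1, 2, 3, 4, 5}"
      using less.prems by auto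
    \<comment> \<open>1.08 is 6/5 times the lower bound 0.9 for
      \<open>chebyshev_const\<close>.\<close>
    hence "ln (fact n) \<le> 1.08 * real n"
      using ln_2_bounds ln_3_bounds ln_5_bounds ln_6_eq
        ln_mult[of 4 "6 :: real"] ln_mult[of 24 "5 :: real"] ln_mult[of 2 "2 :: real"]
      by (auto simp: fact_numeral)
    also have "\<dots> = 6 / 5 * 0.9 * n"
      by simp
    also have "\<dots> \<le> 6 / 5 * chebyshev_const * n"
      using chebyshev_const_ge by (intro mult_right_mono mult_left_mono) auto
    moreover have "ln (real n) \<ge> 0"
      using less.prems by simp
    ultimately show ?thesis
      using chebyshev_psi_le_ln_fact[of n] zero_le_power2[of "ln (real n)"] by linarith
  next
    case False
    define m where "m = n div 6"
    have m: "1 \<le> m" "m < n" "real m \<le> n / 6"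
      using False of_nat_div_le_of_nat[of n 6, where ?'a = real]
      by (auto simp: m_def Suc_le_eq div_greater_zero_iff)
    have ln_m: "0 \<le> ln (real m)" "ln m \<le> ln n - ln 6"
    proof -
      have "ln (real m) \<le> ln (n / 6)"
        using m by (subst ln_le_cancel_iff) auto
      thus "ln (real m) \<le> ln n - ln 6"
        using False by (simp add: ln_div)
    qed (use m in simp)
    have "chebyshev_psi m \<le> 6 / 5 * chebyshev_const * m + 3 / 2 * (ln m)\<^sup>2 + ln m"
      using less.IH[of m] m by simp
    also have "6 / 5 * chebyshev_const * m \<le> 6 / 5 * chebyshev_const * (n / 6)"
      using m chebyshev_const_ge by (intro mult_left_mono) auto
    also have "(ln (real m))\<^sup>2 \<le> (ln n - ln 6)\<^sup>2"
      using ln_m by (intro power_mono) auto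
    finally have "chebyshev_psi m \<le> chebyshev_const * n / 5 + 3 / 2 * (ln n - ln 6)\<^sup>2 + (ln n - ln 6)"
      using ln_m by simp
    moreover have "chebyshev_psi n \<le> chebyshev_psi m + (chebyshev_const * n + 5 * ln n - ln 30 - 1)"
      using psi_diff_le_chebyshev_quotient[of n] chebyshev_quotient_le[of n] False by (simp add: m_def)
    \<comment> \<open>The second line is the excess over the claim. The coefficient 3/2 makes it
      nonpositive: replacing \<open>ln n\<close> by \<open>ln n - ln 6\<close> in the square saves
      \<open>3 * ln 6 * ln n\<close>, and \<open>3 * ln 6 > 5\<close>.\<close>
    ultimately have "chebyshev_psi n \<le> 6 / 5 * chebyshev_const * n + 3 / 2 * (ln n)\<^sup>2 + ln n +
        ((5 - 3 * ln 6) * ln n + (3 / 2 * (ln 6)\<^sup>2 - ln 6 - ln 30 - 1))"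
      by (simp add: power2_eq_square algebra_simps)
    moreover have "(5 - 3 * ln 6) * ln n \<le> 0"
      using False ln_2_bounds ln_3_bounds by (intro mult_nonpos_nonneg) (auto simp: ln_6_eq)
    moreover have "(ln (6 :: real))\<^sup>2 \<le> 1.8\<^sup>2"
      using ln_2_bounds ln_3_bounds by (intro power_mono) (auto simp: ln_6_eq)
    hence "3 / 2 * (ln 6)\<^sup>2 - ln 6 - ln 30 - 1 \<le> (0 :: real)"
      using ln_2_bounds ln_3_bounds ln_5_bounds by (simp add: ln_6_eq ln_30_eq power2_eq_square)
    ultimately show ?thesis
      by linarith
  qed
qed

section \<open>Prime-free gaps and the contradiction for large \<open>y\<close>\<close>

text \<open>Only powers \<open>p ^ k\<close> with \<open>k \<ge> 2\<close> contribute, so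
  \<open>p \<le> sqrt w\<close>. Each \<open>p\<close> has at most one power in the gap because
  \<open>w < 2 * (u + 1)\<close>. Hence there are at most \<open>sqrt w\<close> terms, each at most
  \<open>ln (sqrt w)\<close>.\<close>

lemma sum_mangoldt_no_primes_le:
  fixes u w :: nat
  assumes no_primes: "\<And>p. prime p \<Longrightarrow> u < p \<Longrightarrow> p \<le> w \<Longrightarrow> False"
  assumes "w \<le> 2 * u + 1" "w \<ge> 1"
  shows   "(\<Sum>d\<in>{u<..w}. mangoldt d) \<le> sqrt w * (ln w / 2)"
proof -
  define P where "P = {d \<in> {u<..w}. primepow d}"
  have decompose: "\<exists>k\<ge>2. d = aprimedivisor d ^ k \<and> prime (aprimedivisor d)" if "d \<in> P" for d
  proof -
    from that obtain p k where pk: "prime p" "k > 0" "d = p ^ k"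
      by (auto simp: P_def primepow_def)
    have "k \<noteq> 1"
      using no_primes[of p] pk that by (auto simp: P_def)
    moreover have "aprimedivisor d = p"
      using pk by (simp add: aprimedivisor_prime_power)
    ultimately show ?thesis
      using pk by (intro exI[of _ k]) auto
  qed
  have apd_le: "real (aprimedivisor d) \<le> sqrt w" "aprimedivisor d \<ge> 1" if "d \<in> P" for d
  proof -
    from decompose[OF that] obtain k
      where k: "k \<ge> 2" "d = aprimedivisor d ^ k" "prime (aprimedivisor d)" by blast
    show ge: "aprimedivisor d \<ge> 1"
      using prime_gt_0_nat[OF k(3)] by simp
    have "aprimedivisor d ^ 2 \<le> aprimedivisor d ^ k"
      using k ge by (intro power_increasing) auto
    also have "\<dots> = d" using k by simp
    also have "\<dots> \<le> w" using that by (simp add: P_def)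
    finally show "real (aprimedivisor d) \<le> sqrt w"
      by (intro real_le_rsqrt) (simp flip: of_nat_power)
  qed
  \<comment> \<open>Consecutive powers of a prime differ by a factor of at least 2.\<close>
  have not_less: "\<not> d < e" if same: "d \<in> P" "e \<in> P" "aprimedivisor d = aprimedivisor e" for d e
  proof
    assume "d < e"
    define p where "p = aprimedivisor e"
    obtain i where i: "d = p ^ i" using decompose[OF same(1)] same(3) by (auto simp: p_def)
    obtain j where j: "e = p ^ j" "prime p" using decompose[OF same(2)] by (auto simp: p_def)
    have p: "p \<ge> 2" using j prime_ge_2_nat by blast
    have "i < j" using \<open>d < e\<close> p unfolding i j by (simp add: power_strict_increasing_iff)
    have "2 * d \<le> p ^ Suc i" using p by (simp add: i)
    also have "\<dots> \<le> e" unfolding j using p \<open>i < j\<close> by (intro power_increasing) auto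
    finally show False using same assms by (auto simp: P_def)
  qed
  have "inj_on aprimedivisor P"
  proof (rule inj_onI)
    fix d e assume "d \<in> P" "e \<in> P" "aprimedivisor d = aprimedivisor e"
    thus "d = e" using not_less[of d e] not_less[of e d] by simp
  qed
  moreover have "aprimedivisor ` P \<subseteq> {1..nat \<lfloor>sqrt w\<rfloor>}"
    using apd_le by (auto simp: le_nat_floor)
  ultimately have "card P \<le> card {1..nat \<lfloor>sqrt w\<rfloor>}"
    by (intro card_inj_on_le[of aprimedivisor]) auto
  hence card: "real (card P) \<le> sqrt w"
    by (simp add: le_nat_iff le_floor_iff)
  have "(\<Sum>d\<in>{u<..w}. mangoldt d) = (\<Sum>d\<in>P. ln (real (aprimedivisor d)))"
    by (intro sum.mono_neutral_cong_right) (auto simp: P_def mangoldt_def)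
  also have "\<dots> \<le> (\<Sum>d\<in>P. ln w / 2)"
  proof (intro sum_mono)
    fix d assume "d \<in> P"
    hence "ln (real (aprimedivisor d)) \<le> ln (sqrt w)"
      using apd_le[of d] assms by (subst ln_le_cancel_iff) auto
    thus "ln (real (aprimedivisor d)) \<le> ln w / 2"
      using assms by (simp add: ln_sqrt)
  qed
  also have "\<dots> = card P * (ln w / 2)"
    by simp
  also have "\<dots> \<le> sqrt w * (ln w / 2)"
    using card assms by (intro mult_right_mono) auto
  finally show ?thesis .
qed

lemma large_gap_inequality:
  fixes t :: real
  assumes "t \<ge> 10000"
  shows   "6 * ln t + 3 / 2 * (ln t)\<^sup>2 + sqrt t * (ln t / 2) < 0.09 * t"
proof -
  define s where "s = sqrt (sqrt t)"
  have s2: "sqrt t = s ^ 2"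
    using assms by (simp add: s_def)
  have "t = (sqrt t) ^ 2"
    using assms by simp
  also have "\<dots> = s ^ 4"
    by (simp add: s2 flip: power_mult)
  finally have s4: "t = s ^ 4" .
  have "sqrt (sqrt 10000) \<le> s"
    unfolding s_def using assms by (intro real_sqrt_le_mono)
  moreover have "sqrt 10000 = (100 :: real)" "sqrt 100 = (10 :: real)"
    using real_sqrt_abs[of 100] real_sqrt_abs[of 10] by simp_all
  ultimately have s: "s \<ge> 10" by simp
  define L where "L = ln t"
  \<comment> \<open>The tangent of \<open>ln\<close> at 10, the least value of \<open>s\<close>;
    1.31 below bounds \<open>ln 10 - 1\<close>.\<close>
  have "ln (s / 10) \<le> s / 10 - 1"
    using s by (intro ln_le_minus_one) auto
  hence "ln s \<le> s / 10 + 1.31"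
    using s ln_2_bounds ln_5_bounds by (simp add: ln_div ln_10_eq)
  moreover have "L = 4 * ln s"
    using s by (simp add: L_def s4 ln_realpow)
  ultimately have L: "L \<le> 0.4 * s + 5.24" by simp
  have L0: "0 \<le> L" using assms by (simp add: L_def)
  define h where "h = s - 10"
  have h: "h \<ge> 0" "s = h + 10" using s by (simp_all add: h_def)
  have "6 * L + 3 / 2 * L\<^sup>2 + s ^ 2 * (L / 2) \<le>
      6 * (0.4 * s + 5.24) + 3 / 2 * (0.4 * s + 5.24)\<^sup>2 + s ^ 2 * ((0.4 * s + 5.24) / 2)"
    using L L0 by (intro add_mono mult_left_mono power_mono divide_right_mono) auto
  also have "\<dots> < 0.09 * s ^ 4"
  proof -
    \<comment> \<open>Expanded around \<open>s = 10\<close>, the difference is a polynomial in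
      \<open>h \<ge> 0\<close> with only positive coefficients.\<close>
    have "0.09 * s ^ 4 -
        (6 * (0.4 * s + 5.24) + 3 / 2 * (0.4 * s + 5.24)\<^sup>2 + s ^ 2 * ((0.4 * s + 5.24) / 2)) =
        0.09 * h ^ 4 + 3.4 * h ^ 3 + 45.14 * h ^ 2 + 234.112 * h + 254.4936"
      unfolding h(2) by (simp add: power2_eq_square power3_eq_cube power4_eq_xxxx field_simps)
    moreover have "0 < 0.09 * h ^ 4 + 3.4 * h ^ 3 + 45.14 * h ^ 2 + 234.112 * h + 254.4936"
      using h(1) by (intro add_nonneg_pos add_nonneg_nonneg) auto
    ultimately show ?thesis
      by linarith
  qed
  finally show ?thesis
    by (simp only: L_def flip: s2 s4)
qed

text \<open>With \<open>t = 4 / 3 * y\<close>, the upper bound for psi at \<open>y\<close> has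
  leading coefficient 6/5 * 3/4 = 9/10 of \<open>chebyshev_const\<close>, against the full constant
  in the lower bound just below \<open>t\<close>. The surplus of at least \<open>0.09 * t\<close>
  exceeds all error terms and the prime powers once \<open>t \<ge> 10000\<close>.\<close>

lemma prime_between_4_3_large:
  fixes y :: real
  assumes "y \<ge> 7500"
  shows   "\<exists>p. prime p \<and> y < real p \<and> real p < 4 / 3 * y"
proof (rule ccontr)
  assume no_prime: "\<not> ?thesis"
  define t where "t = 4 / 3 * y"
  define u where "u = nat \<lfloor>y\<rfloor>"
  \<comment> \<open>The largest integer strictly below \<open>t\<close>, so that
    \<open>u < p \<le> w\<close> means exactly \<open>y < p < t\<close>.\<close>
  define w where "w = nat (\<lceil>t\<rceil> - 1)"
  have t: "t \<ge> 10000" using assms by (simp add: t_def)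
  have u: "real u \<le> y" "y < real u + 1" "u \<ge> 1"
    using assms unfolding u_def by linarith+
  have w: "real w < t" "t - 1 \<le> real w"
    using t unfolding w_def by linarith+
  have "u \<le> w"
    using u w t assms unfolding t_def by linarith
  have "chebyshev_psi w = (\<Sum>d\<in>{1..u} \<union> {u<..w}. mangoldt d)"
    unfolding chebyshev_psi_def using \<open>u \<le> w\<close> by (intro sum.cong) auto
  also have "\<dots> = chebyshev_psi u + (\<Sum>d\<in>{u<..w}. mangoldt d)"
    unfolding chebyshev_psi_def by (intro sum.union_disjoint) auto
  also have "(\<Sum>d\<in>{u<..w}. mangoldt d) \<le> sqrt w * (ln w / 2)"
  proof (intro sum_mangoldt_no_primes_le)
    fix p assume "prime p" "u < p" "p \<le> w"
    hence "y < real p" "real p < t"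
      using u w by linarith+
    thus False
      using no_prime \<open>prime p\<close> by (auto simp: t_def)
  qed (use u w t assms in \<open>simp_all add: t_def\<close>)
  also have "\<dots> \<le> sqrt t * (ln t / 2)"
    using w t by (intro mult_mono) auto
  also have "chebyshev_psi u \<le> 6 / 5 * chebyshev_const * u + 3 / 2 * (ln u)\<^sup>2 + ln u"
    using u by (intro chebyshev_psi_le) auto
  also have "6 / 5 * chebyshev_const * u \<le> 6 / 5 * chebyshev_const * (3 / 4 * t)"
    using u chebyshev_const_ge by (intro mult_left_mono) (auto simp: t_def)
  also have "(ln (real u))\<^sup>2 \<le> (ln t)\<^sup>2"
    using u t by (intro power_mono) (auto simp: t_def)
  also have "ln (real u) \<le> ln t"
    using u t by (auto simp: t_def)
  finally have upper: "chebyshev_psi w \<le>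
      9 / 10 * chebyshev_const * t + 3 / 2 * (ln t)\<^sup>2 + ln t + sqrt t * (ln t / 2)"
    by simp
  have "chebyshev_const * (t - 1) - 5 * ln t + 2 * ln 30 - 1 \<le>
        chebyshev_const * w - 5 * ln w + 2 * ln 30 - 1"
    using chebyshev_const_ge w t by (intro diff_mono add_mono mult_left_mono) auto
  also have "\<dots> \<le> chebyshev_psi w"
    using w t by (intro chebyshev_psi_ge) linarith
  finally have "chebyshev_const * (t / 10 - 1) \<le>
      6 * ln t + 3 / 2 * (ln t)\<^sup>2 + sqrt t * (ln t / 2) - 2 * ln 30 + 1"
    using upper by (simp add: algebra_simps)
  moreover have "0.9 * (t / 10 - 1) \<le> chebyshev_const * (t / 10 - 1)"
    using chebyshev_const_ge t by (intro mult_right_mono) auto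
  \<comment> \<open>\<open>2 * ln 30 \<ge> 6\<close> outweighs the constants 1 and 0.9.\<close>
  moreover have "ln (30 :: real) \<ge> 3"
    using ln_2_bounds ln_3_bounds ln_5_bounds by (simp add: ln_30_eq)
  ultimately show False
    using large_gap_inequality[OF t] by simp
qed

section \<open>Explicit primes for small \<open>y\<close>\<close>

lemma prime_natI_sqrt:
  fixes n k :: nat
  assumes "1 < n" "n < k * k" "\<forall>d\<in>set [2..<k]. \<not> d dvd n"
  shows   "prime n"
proof (rule ccontr)
  assume "\<not> prime n"
  with assms(1) obtain d where d: "d dvd n" "d \<noteq> 1" "d \<noteq> n"
    by (auto simp: prime_nat_iff)
  then obtain e where e: "n = d * e" by blast
  have "d \<ge> 2" "e \<ge> 2"
    using d assms(1) e by (auto simp: numeral_2_eq_2 Suc_le_eq intro!: Nat.gr0I Suc_lessI)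
  moreover have "d < k \<or> e < k"
    using assms(2) e mult_le_mono[of k d k e] by linarith
  ultimately show False
    using assms(3) e dvd_triv_left[of d e] dvd_triv_right[of e d] by fastforce
qed

text \<open>At the first entry \<open>q\<close> above \<open>y\<close>, its predecessor
  \<open>r\<close> satisfies \<open>r \<le> y < q < 4 / 3 * r \<le> 4 / 3 * y\<close>, so
  \<open>q\<close> is the witness. If there is none, \<open>y\<close> has reached the end of the
  chain.\<close>

lemma prime_between_of_prime_chain:
  fixes y :: real
  assumes "successively (\<lambda>r q. 3 * q < 4 * r) (r # qs)" "\<forall>q\<in>set qs. prime q" "real r \<le> y"
  shows   "(\<exists>p. prime p \<and> y < real p \<and> real p < 4 / 3 * y) \<or> real (last (r # qs)) \<le> y"
  using assms
proof (induction qs arbitrary: r)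
  case (Cons q qs)
  show ?case
  proof (cases "real q \<le> y")
    case True
    thus ?thesis
      using Cons.IH[of q] Cons.prems by simp
  next
    case False
    moreover have "3 * real q < 4 * real r"
      using Cons.prems(1) by simp
    hence "real q < 4 / 3 * y"
      using Cons.prems(3) by linarith
    ultimately show ?thesis
      using Cons.prems(2) by (auto intro!: exI[of _ q])
  qed
qed simp

lemma prime_between_4_3:
  fixes y :: real
  assumes "y \<ge> 13"
  shows   "\<exists>p. prime p \<and> y < real p \<and> real p < 4 / 3 * y"
proof -
  have primes: "prime (17::nat)" "prime (19::nat)" "prime (23::nat)" "prime (29::nat)"
    "prime (37::nat)" "prime (47::nat)" "prime (61::nat)" "prime (79::nat)" "prime (103::nat)"
    "prime (137::nat)" "prime (181::nat)" "prime (241::nat)" "prime (317::nat)" "prime (421::nat)"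
    "prime (557::nat)" "prime (739::nat)" "prime (983::nat)" "prime (1307::nat)" "prime (1741::nat)"
    "prime (2311::nat)" "prime (3079::nat)" "prime (4099::nat)" "prime (5449::nat)"
    "prime (7253::nat)" "prime (9661::nat)"
    \<comment> \<open>Trial division with bounds 5, 12, 30 and 100 handles primes below 25, 144, 900
      and 10000; the first bound that suffices is used.\<close>
    by ((rule prime_natI_sqrt[of _ 5], simp, simp, simp; fail) |
        (rule prime_natI_sqrt[of _ 12], simp, simp, simp; fail) |
        (rule prime_natI_sqrt[of _ 30], simp, simp, simp; fail) |
        (rule prime_natI_sqrt[of _ 100], simp, simp, simp; fail))+
  \<comment> \<open>The chain starts at the least admissible \<open>y\<close> and ends beyond 7500,
    where the analytic argument takes over.\<close>
  have "(\<exists>p. prime p \<and> y < real p \<and> real p < 4 / 3 * y) \<or>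
    real (last (13 # [17, 19, 23, 29, 37, 47, 61, 79, 103, 137, 181, 241, 317,
      421, 557, 739, 983, 1307, 1741, 2311, 3079, 4099, 5449, 7253, 9661])) \<le> y"
    by (rule prime_between_of_prime_chain)
       (use assms primes in \<open>simp_all del: prime_nat_numeral_eq\<close>)
  thus ?thesis
    using prime_between_4_3_large[of y] by force
qed

theorem theorem6p6:
  fixes a n :: nat
  assumes "a > 1" and "n > 0" and "real n > 14.4 * real a"
  shows "\<exists>p q r s :: nat. prime p \<and> prime q \<and> prime r \<and> prime s \<and>
    real n < real (a * p) \<and> real (a * p) < 3 * real n / 2 \<and>
    3 * real n / 2 < real (a * q) \<and> real (a * q) < 2 * real n \<and>
    real n < real r \<and> real r < 3 * real n / 2 \<and>
    3 * real n / 2 < real s \<and> real s < 2 * real n"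
proof -
  \<comment> \<open>Both \<open>x\<close> and \<open>3 / 2 * x\<close> are at least 13. The first
    prime stays below \<open>3 / 2 * x\<close> since 4/3 < 3/2, the second below
    \<open>2 * x\<close> since 4/3 * 3/2 = 2.\<close>
  have two_primes: "\<exists>p q. prime p \<and> prime q \<and> x < real p \<and> real p < 3 / 2 * x \<and>
      3 / 2 * x < real q \<and> real q < 2 * x" if "x \<ge> 14.4" for x :: real
  proof -
    obtain p where "prime p" "x < real p" "real p < 4 / 3 * x"
      using prime_between_4_3[of x] \<open>x \<ge> 14.4\<close> by auto
    moreover obtain q where "prime q" "3 / 2 * x < real q" "real q < 4 / 3 * (3 / 2 * x)"
      using prime_between_4_3[of "3 / 2 * x"] \<open>x \<ge> 14.4\<close> by auto
    ultimately show ?thesis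
      using \<open>x \<ge> 14.4\<close> by (intro exI[of _ p] exI[of _ q]) auto
  qed
  have "real n / a \<ge> 14.4"
    using assms by (simp add: field_simps)
  then obtain p q where "prime p" "prime q" "real n / a < real p" "real p < 3 / 2 * (real n / a)"
      "3 / 2 * (real n / a) < real q" "real q < 2 * (real n / a)"
    using two_primes by blast
  moreover have "real n \<ge> 14.4"
    using assms by linarith
  then obtain r s where "prime r" "prime s" "real n < real r" "real r < 3 / 2 * real n"
      "3 / 2 * real n < real s" "real s < 2 * real n"
    using two_primes by blast
  ultimately show ?thesis
    using assms(1) by (intro exI[of _ p] exI[of _ q] exI[of _ r] exI[of _ s]) (simp add: field_simps)
qed

end
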